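(* Let $\{M_0(t)\}_{t\ge0}$ and $\{M(t)\}_{t\ge0}$ be independent generalized counting processes with positive rates $\mu_1,\dots,\mu_{k_0}$ and $\lambda_1,\dots,\lambda_k$, respectively, let $\hat M(t)=M(M_0(t))$ and $\lambda=\sum_{j=1}^{k}\lambda_j$. For all $n\ge0$ and $t\ge0$, the state probabilities $\hat p(n,t)=\mathrm{Pr}\{\hat M(t)=n\}$ are given by $$\hat p(n,t)=\sum_{\Omega(k,n)}\Big(\prod_{j=1}^{k}\frac{\lambda_j^{n_j}}{n_j!}\Big)\sum_{\sum_{j_0=1}^{k_0}r_{j_0}=z_k}z_k!\prod_{j_0=1}^{k_0}\frac{j_0^{r_{j_0}}}{r_{j_0}!}\,e^{-\mu_{j_0}t(1-e^{-j_0\lambda})}\,\mathcal{B}_{r_{j_0}}\big(e^{-j_0\lambda}\mu_{j_0}t\big),$$ where $z_k=n_1+n_2+\dots+n_k$, the first sum is over $(n_1,\dots,n_k)\in\Omega(k,n)$ and the second sum is over non-negative integers $r_1,\dots,r_{k_0}$ with $r_1+\dots+r_{k_0}=z_k$.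
   Context: A generalized counting process (GCP) $\{M(t)\}_{t\ge0}$ with positive rates $\lambda_1,\dots,\lambda_k$ is a right-continuous $\mathbb{N}_0$-valued process with $M(0)=0$ and stationary independent increments, whose probability generating function is $\mathbb{E}(u^{M(t)})=\exp\big(-t\sum_{j=1}^{k}\lambda_j(1-u^j)\big)$, $|u|\le1$. The process $\hat M(t)=M(M_0(t))$ is called the iterated generalized counting process (IGCP). $\Omega(k,n)=\{(n_1,\dots,n_k)\in\mathbb{N}_0^k: n_1+2n_2+\dots+kn_k=n\}$. The Bell polynomial of order $n\ge0$ is $\mathcal{B}_n(x)=e^{-x}\sum_{r=0}^{\infty}\frac{r^n x^r}{r!}$, with the convention $0^0=1$. *)

theory Defs
  imports "HOL-Probability.Probability"
begin

text \<open>
  Time is indexed by type \<^typ>\<open>real\<close>; only the values at times \<open>t \<ge> 0\<close> are constrained.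
  Increments are taken in \<^typ>\<open>int\<close>, since subtraction on \<^typ>\<open>nat\<close> truncates and monotonicity
  of the paths is not part of the definition. The initial condition and right-continuity are
  required almost surely.
\<close>

locale generalized_counting_process = prob_space P
  for P :: "'a measure" +
  fixes k :: nat and rate :: "nat \<Rightarrow> real" and X :: "real \<Rightarrow> 'a \<Rightarrow> nat"
  assumes num_rates: "k \<ge> 1"
    and rate_pos: "\<And>j. j \<in> {1..k} \<Longrightarrow> rate j > 0"
    and random_variable: "\<And>t. t \<ge> 0 \<Longrightarrow> X t \<in> measurable P (count_space UNIV)"
    and initial: "AE \<omega> in P. X 0 \<omega> = 0"
    and right_continuous: "AE \<omega> in P. \<forall>t\<ge>0. continuous (at_right t) (\<lambda>s. X s \<omega>)"
    and stationary_increments: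
      "\<And>s h. s \<ge> 0 \<Longrightarrow> h \<ge> 0 \<Longrightarrow>
        distr P (count_space UNIV) (\<lambda>\<omega>. int (X (s + h) \<omega>) - int (X s \<omega>)) =
        distr P (count_space UNIV) (\<lambda>\<omega>. int (X h \<omega>) - int (X 0 \<omega>))"
    and independent_increments:
      "\<And>(m::nat) (s :: nat \<Rightarrow> real). s 0 \<ge> 0 \<Longrightarrow> (\<And>i. i < m \<Longrightarrow> s i \<le> s (Suc i)) \<Longrightarrow>
        indep_vars (\<lambda>_. count_space UNIV)
          (\<lambda>i \<omega>. int (X (s (Suc i)) \<omega>) - int (X (s i) \<omega>)) {..<m}"
    and pgf: "\<And>t (u::real). t \<ge> 0 \<Longrightarrow> \<bar>u\<bar> \<le> 1 \<Longrightarrow>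
      expectation (\<lambda>\<omega>. u ^ X t \<omega>) = exp (- t * (\<Sum>j=1..k. rate j * (1 - u ^ j)))"

text \<open>
  Independence of two processes as random elements of the path space \<open>\<nat>\<^bsup>[0,\<infinity>)\<^esup>\<close> with its product
  \<open>\<sigma>\<close>-algebra.
\<close>

definition independent_processes ::
    "'a measure \<Rightarrow> (real \<Rightarrow> 'a \<Rightarrow> nat) \<Rightarrow> (real \<Rightarrow> 'a \<Rightarrow> nat) \<Rightarrow> bool" where
  "independent_processes P X Y \<longleftrightarrow>
    prob_space.indep_var P
      (PiM {0..} (\<lambda>_. count_space UNIV)) (\<lambda>\<omega>. \<lambda>t\<in>{0..}. X t \<omega>)
      (PiM {0..} (\<lambda>_. count_space UNIV)) (\<lambda>\<omega>. \<lambda>t\<in>{0..}. Y t \<omega>)"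

definition iterated_process ::
    "(real \<Rightarrow> 'a \<Rightarrow> nat) \<Rightarrow> (real \<Rightarrow> 'a \<Rightarrow> nat) \<Rightarrow> real \<Rightarrow> 'a \<Rightarrow> nat" where
  "iterated_process X X0 t \<omega> = X (real (X0 t \<omega>)) \<omega>"

text \<open>
  Tuples indexed by \<open>1, \<dots>, k\<close> are functions on \<open>{1..k}\<close>, made unique by taking them extensional.
\<close>

definition Omega_set :: "nat \<Rightarrow> nat \<Rightarrow> (nat \<Rightarrow> nat) set" where
  "Omega_set k n = {\<nu> \<in> {1..k} \<rightarrow>\<^sub>E UNIV. (\<Sum>j=1..k. j * \<nu> j) = n}"

definition compositions :: "nat \<Rightarrow> nat \<Rightarrow> (nat \<Rightarrow> nat) set" where
  "compositions k z = {r \<in> {1..k} \<rightarrow>\<^sub>E UNIV. (\<Sum>j=1..k. r j) = z}"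

definition bell_poly :: "nat \<Rightarrow> real \<Rightarrow> real" where
  "bell_poly n x = exp (- x) * (\<Sum>r. real r ^ n * x ^ r / fact r)"

end

theory Submission
  imports Defs
begin

text \<open>
  A counting process with rates \<open>\<lambda>\<^sub>1, \<dots>, \<lambda>\<^sub>k\<close> has at time \<open>t\<close> the law of \<open>\<Sum>j. j * N\<^sub>j\<close> with independent
  Poisson variables \<open>N\<^sub>j\<close> of means \<open>\<lambda>\<^sub>j * t\<close>, because the generating functions agree. Hence
  \<open>Pr (M m = n)\<close> is a sum over \<open>\<Omega>(k, n)\<close> of multiples of \<open>m ^ z * exp (- \<Lambda> * m)\<close>, and by independence
  the state probability of \<open>M (M\<^sub>0 t)\<close> is its mean at \<open>m = M\<^sub>0 t\<close>. Expanding \<open>(\<Sum>j. j * N\<^sub>j) ^ z\<close> by the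
  multinomial theorem factorises this mean into exponentially tilted Poisson moments, which are
  Bell polynomials.
\<close>

section \<open>Laws on the naturals and their generating functions\<close>

text \<open>Once the coefficients below \<open>n\<close> vanish, dividing by \<open>x ^ n\<close>
  leaves a series that is zero on \<open>(0, r)\<close> and has the value \<open>c n\<close> at 0;
  continuity carries the zero over.\<close>

lemma powser_eq_0_imp_coeff_0:
  fixes c :: "nat \<Rightarrow> real"
  assumes "r > 0" and sums: "\<And>x. 0 < x \<Longrightarrow> x < r \<Longrightarrow> (\<lambda>n. c n * x ^ n) sums 0"
  shows "c n = 0"
proof (induction n rule: less_induct)
  case (less n)
  have shift: "(\<lambda>i. c (i + n) * x ^ i) sums 0" if "0 < x" "x < r" for x
  proof -
    have "(\<lambda>i. c (i + n) * x ^ (i + n)) sums (0 - (\<Sum>i<n. c i * x ^ i))"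
      by (intro sums_split_initial_segment sums that)
    then have "(\<lambda>i. x ^ n * (c (i + n) * x ^ i)) sums (x ^ n * 0)"
      by (simp add: less power_add mult_ac)
    then show ?thesis
      by (subst (asm) sums_mult_iff) (use that in auto)
  qed
  let ?f = "\<lambda>x. \<Sum>i. c (i + n) * x ^ i"
  \<comment> \<open>The series converges at \<open>r / 2\<close>, so 0 is interior to its disc of
    convergence. The limit is then taken from the right, where the sum is known.\<close>
  have "isCont ?f 0"
    using sums_summable[OF shift[of "r / 2"]] \<open>r > 0\<close> by (intro isCont_powser[of _ "r / 2"]) auto
  then have lim: "(?f \<longlongrightarrow> ?f 0) (at_right 0)"
    unfolding isCont_def by (rule filterlim_mono) (auto intro: at_le)
  have ev: "eventually (\<lambda>x. ?f x = 0) (at_right 0)"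
    using eventually_at_right_less[of 0] \<open>r > 0\<close> shift
    by (auto simp: eventually_at_right_field sums_iff)
  have "?f 0 = 0"
    using tendsto_cong[OF ev] lim by (simp add: tendsto_const_iff)
  then show ?case
    by simp
qed

text \<open>The bridge from expectations to series: the mass function is a density with respect to
  counting measure, and integrability there yields convergence.\<close>

lemma sums_expectation_nat_pmf:
  fixes f :: "nat \<Rightarrow> real"
  assumes "integrable (measure_pmf p) f"
  shows "(\<lambda>m. pmf p m * f m) sums measure_pmf.expectation p f"
proof -
  have "integrable (count_space UNIV) (\<lambda>m. pmf p m *\<^sub>R f m)"
    using assms unfolding measure_pmf_eq_density by (subst (asm) integrable_density) auto
  from sums_integral_count_space_nat[OF this] show ?thesis
    unfolding measure_pmf_eq_density by (subst integral_density) auto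
qed

lemma integrable_power_nat_pmf:
  fixes u :: real
  assumes "\<bar>u\<bar> \<le> 1"
  shows "integrable (measure_pmf p) (\<lambda>m. u ^ g m)"
  by (rule measure_pmf.integrable_const_bound[where B = 1])
     (use assms in \<open>auto simp: power_abs power_le_one\<close>)

text \<open>The difference of the generating functions is a power series vanishing on
  \<open>(0, 1)\<close>, so its coefficients, the differences of the masses, are zero.\<close>

lemma pmf_eqI_pgf:
  fixes p q :: "nat pmf"
  assumes "\<And>u :: real. 0 \<le> u \<Longrightarrow> u \<le> 1 \<Longrightarrow>
    measure_pmf.expectation p (\<lambda>m. u ^ m) = measure_pmf.expectation q (\<lambda>m. u ^ m)"
  shows "p = q"
proof (rule pmf_eqI)
  fix n
  have "(\<lambda>m. (pmf p m - pmf q m) * u ^ m) sums 0" if u: "0 < u" "u < 1" for u :: real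
  proof -
    have *: "(\<lambda>m. pmf p m * u ^ m) sums measure_pmf.expectation p (\<lambda>m. u ^ m)" for p
      using u by (intro sums_expectation_nat_pmf integrable_power_nat_pmf) auto
    show ?thesis
      using sums_diff[OF *[of p] *[of q]] assms[of u] u by (simp add: left_diff_distrib)
  qed
  then have "pmf p n - pmf q n = 0"
    by (rule powser_eq_0_imp_coeff_0[OF zero_less_one])
  then show "pmf p n = pmf q n" by simp
qed

text \<open>A probability law on a countable type is carried by its atoms. Passing to a
  \<open>pmf\<close> makes comparison by generating functions available.\<close>

lemma (in prob_space) obtain_distr_pmf:
  fixes X :: "'a \<Rightarrow> 'b :: countable"
  assumes "X \<in> measurable M (count_space UNIV)"
  obtains p where "distr M (count_space UNIV) X = measure_pmf p"
proof -
  let ?D = "distr M (count_space UNIV) X"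
  interpret D: prob_space ?D
    using assms by (rule prob_space_distr)
  have "AE x in ?D. measure ?D {x} \<noteq> 0"
    by (subst D.AE_support_countable) (auto intro!: exI[of _ UNIV])
  then have "measure_pmf (Abs_pmf ?D) = ?D"
    by (intro Abs_pmf_inverse) (auto intro: D.prob_space_axioms)
  then show thesis using that by metis
qed

section \<open>Poisson laws and their exponentially tilted moments\<close>

text \<open>The library's \<^const>\<open>poisson_pmf\<close> is unspecified for rate 0, which is needed at time 0.\<close>

definition poisson0_pmf :: "real \<Rightarrow> nat pmf" where
  "poisson0_pmf a = (if a = 0 then return_pmf 0 else poisson_pmf a)"

text \<open>At \<open>a = 0\<close> the convention \<open>0 ^ 0 = 1\<close> turns the Poisson
  formula into the unit mass at 0.\<close>

lemma pmf_poisson0: "a \<ge> 0 \<Longrightarrow> pmf (poisson0_pmf a) m = a ^ m / fact m * exp (- a)"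
  by (auto simp: poisson0_pmf_def indicator_def power_0_left)

lemma sums_expectation_poisson0:
  assumes "a \<ge> 0" "integrable (measure_pmf (poisson0_pmf a)) f"
  shows "(\<lambda>m. a ^ m / fact m * exp (- a) * f m) sums measure_pmf.expectation (poisson0_pmf a) f"
  using sums_expectation_nat_pmf[OF assms(2)] assms(1) by (simp add: pmf_poisson0)

lemma pgf_poisson0:
  fixes u :: real
  assumes "a \<ge> 0" "\<bar>u\<bar> \<le> 1"
  shows "measure_pmf.expectation (poisson0_pmf a) (\<lambda>m. u ^ m) = exp (- a * (1 - u))"
proof -
  have "(\<lambda>m. exp (- a) * ((a * u) ^ m /\<^sub>R fact m)) sums (exp (- a) * exp (a * u))"
    by (intro sums_mult exp_converges)
  then have "(\<lambda>m. a ^ m / fact m * exp (- a) * u ^ m) sums (exp (- a * (1 - u)))"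
    by (simp add: field_simps power_mult_distrib exp_add[symmetric] scaleR_conv_of_real)
  with sums_expectation_poisson0[OF assms(1) integrable_power_nat_pmf[OF assms(2)], of "\<lambda>m. m"]
  show ?thesis using sums_unique2 by blast
qed

text \<open>With \<open>y = b * m\<close>, the product \<open>y ^ r * exp (- y)\<close> is bounded
  by \<open>fact r\<close>, so integrability holds for every law on the naturals.\<close>

lemma integrable_power_times_exp_pmf:
  fixes b c :: real
  assumes "b > 0"
  shows "integrable (measure_pmf p) (\<lambda>m. (c * real m) ^ r * exp (- b * real m))"
proof (rule measure_pmf.integrable_const_bound[where B = "\<bar>c\<bar> ^ r * (fact r / b ^ r)"])
  have "(real m) ^ r * exp (- b * real m) \<le> fact r / b ^ r" for m
  proof -
    \<comment> \<open>A single term of the exponential series, written as a sum over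
      \<open>{r}\<close>, is at most the whole sum.\<close>
    have "(\<Sum>i\<in>{r}. (b * real m) ^ i /\<^sub>R fact i) \<le> (\<Sum>i. (b * real m) ^ i /\<^sub>R fact i)"
      using assms by (intro sum_le_suminf summable_exp_generic) auto
    then have "(b * real m) ^ r / fact r \<le> exp (b * real m)"
      by (simp add: exp_def field_simps)
    then show ?thesis
      using assms by (simp add: exp_minus field_simps power_mult_distrib)
  qed
  then show "AE m in p. norm ((c * real m) ^ r * exp (- b * real m)) \<le> \<bar>c\<bar> ^ r * (fact r / b ^ r)"
    by (auto simp: abs_mult power_abs power_mult_distrib mult.assoc
        simp del: times_divide_eq_right intro!: AE_pmfI mult_left_mono)
qed auto

text \<open>The tilt merges with \<open>a ^ m\<close> into \<open>x ^ m\<close> for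
  \<open>x = exp (- b) * a\<close>, which gives the Bell series at \<open>x\<close>. Splitting
  \<open>a = a * (1 - exp (- b)) + x\<close> supplies the normalising factors.\<close>

lemma poisson0_tilted_moment:
  assumes "a \<ge> 0" "b > 0"
  shows "measure_pmf.expectation (poisson0_pmf a) (\<lambda>m. (c * real m) ^ r * exp (- b * real m)) =
    c ^ r * exp (- a * (1 - exp (- b))) * bell_poly r (exp (- b) * a)"
proof -
  define x where "x = exp (- b) * a"
  have *: "a ^ m / fact m * exp (- a) * ((c * real m) ^ r * exp (- b * real m)) =
      c ^ r * exp (- a) * (real m ^ r * x ^ m / fact m)" for m c
    by (simp add: x_def power_mult_distrib exp_of_nat_mult[symmetric] mult_ac)
  have sums: "(\<lambda>m. c ^ r * exp (- a) * (real m ^ r * x ^ m / fact m)) sums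
      measure_pmf.expectation (poisson0_pmf a) (\<lambda>m. (c * real m) ^ r * exp (- b * real m))" for c
    using sums_expectation_poisson0[OF assms(1) integrable_power_times_exp_pmf[OF assms(2)], of c r]
    by (simp only: *)
  \<comment> \<open>Taking \<open>c = 1\<close> makes the constant factor nonzero, so it can be
    cancelled; a general \<open>c\<close> may be 0.\<close>
  have "summable (\<lambda>m. real m ^ r * x ^ m / fact m)"
    using sums_summable[OF sums[of 1]] by (subst (asm) summable_cmult_iff) simp
  then have "(\<lambda>m. c ^ r * exp (- a) * (real m ^ r * x ^ m / fact m)) sums
      (c ^ r * exp (- a) * (\<Sum>m. real m ^ r * x ^ m / fact m))"
    by (intro sums_mult summable_sums)
  with sums have "measure_pmf.expectation (poisson0_pmf a) (\<lambda>m. (c * real m) ^ r * exp (- b * real m))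
      = c ^ r * exp (- a) * (\<Sum>m. real m ^ r * x ^ m / fact m)"
    using sums_unique2 by blast
  also have "\<dots> = c ^ r * exp (- a * (1 - exp (- b))) * bell_poly r x"
  proof -
    have "exp (- a) = exp (- a * (1 - exp (- b))) * exp (- x)"
      by (simp add: x_def mult_exp_exp algebra_simps)
    then show ?thesis
      by (simp add: bell_poly_def)
  qed
  finally show ?thesis unfolding x_def .
qed

section \<open>Multinomial expansion\<close>

text \<open>Induction on \<open>A\<close> splits off the exponent of the new element by the binomial
  theorem; extensionality makes each exponent tuple occur exactly once.\<close>

lemma multinomial_ring:
  fixes x :: "'b \<Rightarrow> 'a :: field_char_0"
  assumes "finite A"
  shows "(\<Sum>j\<in>A. x j) ^ z =
    (\<Sum>r | r \<in> A \<rightarrow>\<^sub>E UNIV \<and> sum r A = z. fact z * (\<Prod>j\<in>A. x j ^ r j / fact (r j)))"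
  using assms
proof (induction A arbitrary: z rule: finite_induct)
  case empty
  then show ?case by (cases "z = 0") (auto simp: power_0_left)
next
  case (insert a A)
  let ?C = "\<lambda>A z. {r. r \<in> A \<rightarrow>\<^sub>E UNIV \<and> sum r A = (z :: nat)}"
  let ?w = "\<lambda>A r. \<Prod>j\<in>A. x j ^ r j / fact (r j)"
  have fin: "finite (?C A y)" for y
  proof (rule finite_subset)
    have "r j \<le> sum r A" if "j \<in> A" for r :: "'b \<Rightarrow> nat" and j
      using insert.hyps(1) that by (intro member_le_sum) auto
    then show "?C A y \<subseteq> A \<rightarrow>\<^sub>E {..y}"
      by (auto simp: PiE_iff intro: extensional_arb)
  qed (use insert.hyps(1) in \<open>auto intro: finite_PiE\<close>)
  have upd: "sum (r(a := i)) A = sum r A" "?w A (r(a := i)) = ?w A r" for r and i :: nat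
    using insert.hyps(2) by (auto intro!: sum.cong prod.cong)
  have "(\<Sum>j\<in>insert a A. x j) ^ z = (\<Sum>i\<le>z. of_nat (z choose i) * x a ^ i * sum x A ^ (z - i))"
    using insert.hyps by (simp add: binomial_ring)
  \<comment> \<open>The factor \<open>fact (z - i)\<close> from the induction hypothesis cancels
    against the binomial coefficient.\<close>
  also have "\<dots> = (\<Sum>i\<le>z. \<Sum>r\<in>?C A (z - i). fact z * (x a ^ i / fact i * ?w A r))"
    by (intro sum.cong refl)
       (simp add: insert.IH binomial_fact sum_distrib_left mult_ac)
  also have "\<dots> = (\<Sum>(i, r)\<in>(SIGMA i:{..z}. ?C A (z - i)). fact z * (x a ^ i / fact i * ?w A r))"
    by (rule sum.Sigma) (auto intro: fin)
  \<comment> \<open>The pair \<open>(i, r)\<close> encodes the tuple \<open>r(a := i)\<close>; the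
    inverse resets \<open>a\<close> to \<open>undefined\<close> to return to tuples extensional on
    \<open>A\<close>.\<close>
  also have "\<dots> = (\<Sum>r\<in>?C (insert a A) z. fact z * ?w (insert a A) r)"
    by (rule sum.reindex_bij_witness[where j = "\<lambda>(i, r). r(a := i)"
          and i = "\<lambda>r. (r a, r(a := undefined))"])
       (use insert.hyps in \<open>auto simp: upd upd[unfolded fun_upd_def] PiE_iff extensional_def fun_eq_iff\<close>)
  finally show ?case .
qed

section \<open>One-dimensional laws of a counting process and their tilted moments\<close>

text \<open>A compound Poisson law: component \<open>j\<close> counts the jumps of size
  \<open>j\<close>. The default \<open>undefined\<close> keeps the tuples extensional, as
  \<open>Omega_set\<close> requires.\<close>

definition gcp_pmf :: "nat \<Rightarrow> (nat \<Rightarrow> real) \<Rightarrow> real \<Rightarrow> nat pmf" where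
  "gcp_pmf k rate t = map_pmf (\<lambda>\<nu>. \<Sum>j=1..k. j * \<nu> j)
    (Pi_pmf {1..k} undefined (\<lambda>j. poisson0_pmf (rate j * t)))"

text \<open>The power of \<open>u\<close> splits over the independent components, and component
  \<open>j\<close> contributes a Poisson generating function at \<open>u ^ j\<close>.\<close>

lemma pgf_gcp_pmf:
  fixes u :: real
  assumes "\<And>j. j \<in> {1..k} \<Longrightarrow> rate j > 0" "t \<ge> 0" "0 \<le> u" "u \<le> 1"
  shows "measure_pmf.expectation (gcp_pmf k rate t) (\<lambda>m. u ^ m) =
    exp (- t * (\<Sum>j=1..k. rate j * (1 - u ^ j)))"
proof -
  have a: "rate j * t \<ge> 0" if "j \<in> {1..k}" for j
    using assms(1)[OF that] assms(2) by simp
  have u: "\<bar>u ^ j\<bar> \<le> 1" for j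
    using assms(3,4) by (simp add: power_le_one)
  have "measure_pmf.expectation (gcp_pmf k rate t) (\<lambda>m. u ^ m) =
    measure_pmf.expectation (Pi_pmf {1..k} undefined (\<lambda>j. poisson0_pmf (rate j * t)))
      (\<lambda>\<nu>. \<Prod>j=1..k. (u ^ j) ^ \<nu> j)"
    by (simp add: gcp_pmf_def power_sum power_mult)
  also have "\<dots> = (\<Prod>j=1..k. measure_pmf.expectation (poisson0_pmf (rate j * t)) (\<lambda>m. (u ^ j) ^ m))"
    using assms(3) by (intro expectation_prod_Pi_pmf integrable_power_nat_pmf u) auto
  also have "\<dots> = (\<Prod>j=1..k. exp (- (rate j * t) * (1 - u ^ j)))"
    by (intro prod.cong refl pgf_poisson0 a u)
  also have "\<dots> = exp (- t * (\<Sum>j=1..k. rate j * (1 - u ^ j)))"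
    by (simp add: exp_sum[symmetric] sum_distrib_left sum_negf mult_ac)
  finally show ?thesis .
qed

lemma (in generalized_counting_process) distr_eq_gcp_pmf:
  assumes "t \<ge> 0"
  shows "distr P (count_space UNIV) (X t) = measure_pmf (gcp_pmf k rate t)"
proof -
  obtain p where p: "distr P (count_space UNIV) (X t) = measure_pmf p"
    using obtain_distr_pmf[OF random_variable[OF assms]] by metis
  have "p = gcp_pmf k rate t"
  proof (rule pmf_eqI_pgf)
    fix u :: real
    assume u: "0 \<le> u" "u \<le> 1"
    have "measure_pmf.expectation p (\<lambda>m. u ^ m) = expectation (\<lambda>\<omega>. u ^ X t \<omega>)"
      unfolding p[symmetric] by (rule integral_distr) (auto intro: random_variable assms)
    also have "\<dots> = measure_pmf.expectation (gcp_pmf k rate t) (\<lambda>m. u ^ m)"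
      using u assms pgf[OF assms, of u] pgf_gcp_pmf[OF rate_pos assms u] by simp
    finally show "measure_pmf.expectation p (\<lambda>m. u ^ m) =
      measure_pmf.expectation (gcp_pmf k rate t) (\<lambda>m. u ^ m)" .
  qed
  with p show ?thesis by simp
qed

text \<open>The weights \<open>j\<close> start at 1, so each entry is at most \<open>n\<close>.
  Finiteness lets the probability of this set be summed pointwise.\<close>

lemma finite_Omega_set: "finite (Omega_set k n)"
proof (rule finite_subset)
  have "\<nu> j \<le> (\<Sum>j=1..k. j * \<nu> j)" if "j \<in> {1..k}" for \<nu> :: "nat \<Rightarrow> nat" and j
  proof -
    have "\<nu> j \<le> j * \<nu> j"
      using that by (cases j) auto
    also have "\<dots> \<le> (\<Sum>j=1..k. j * \<nu> j)"
      using that by (intro member_le_sum) auto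
    finally show ?thesis .
  qed
  then show "Omega_set k n \<subseteq> {1..k} \<rightarrow>\<^sub>E {..n}"
    by (auto simp: Omega_set_def PiE_iff simp del: One_nat_def atLeastAtMost_iff intro: extensional_arb)
qed (simp add: finite_PiE)

text \<open>Time enters each summand only through a power times an exponential; this separation
  allows averaging over a random time later.\<close>

lemma pmf_gcp_pmf:
  assumes "\<And>j. j \<in> {1..k} \<Longrightarrow> rate j > 0" "t \<ge> 0"
  shows "pmf (gcp_pmf k rate t) n =
    (\<Sum>\<nu>\<in>Omega_set k n. (\<Prod>j=1..k. rate j ^ \<nu> j / fact (\<nu> j)) *
      (t ^ (\<Sum>j=1..k. \<nu> j) * exp (- (\<Sum>j=1..k. rate j) * t)))"
proof -
  let ?Q = "Pi_pmf {1..k} undefined (\<lambda>j. poisson0_pmf (rate j * t))"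
  have supp: "\<nu> \<in> {1..k} \<rightarrow>\<^sub>E UNIV" if "\<nu> \<in> set_pmf ?Q" for \<nu>
    using that set_Pi_pmf_subset[of "{1..k}" undefined "\<lambda>j. poisson0_pmf (rate j * t)"]
    by (intro PiE_I) auto
  have "pmf (gcp_pmf k rate t) n = measure_pmf.prob ?Q ((\<lambda>\<nu>. \<Sum>j=1..k. j * \<nu> j) -` {n})"
    by (simp add: gcp_pmf_def pmf_map)
  \<comment> \<open>The preimage also contains non-extensional functions, so the two sets agree only
    on the support of \<open>?Q\<close>, hence almost everywhere.\<close>
  also have "\<dots> = measure_pmf.prob ?Q (Omega_set k n)"
    by (intro measure_pmf.finite_measure_eq_AE AE_pmfI) (use supp in \<open>auto simp: Omega_set_def simp del: One_nat_def\<close>)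
  also have "\<dots> = (\<Sum>\<nu>\<in>Omega_set k n. pmf ?Q \<nu>)"
    by (rule measure_measure_pmf_finite) (rule finite_Omega_set)
  also have "\<dots> = (\<Sum>\<nu>\<in>Omega_set k n. (\<Prod>j=1..k. rate j ^ \<nu> j / fact (\<nu> j)) *
      (t ^ (\<Sum>j=1..k. \<nu> j) * exp (- (\<Sum>j=1..k. rate j) * t)))"
  proof (rule sum.cong[OF refl])
    fix \<nu> assume "\<nu> \<in> Omega_set k n"
    then have "pmf ?Q \<nu> = (\<Prod>j=1..k. pmf (poisson0_pmf (rate j * t)) (\<nu> j))"
      by (intro pmf_Pi' PiE_arb[of \<nu> "{1..k}" "\<lambda>_. UNIV"]) (simp_all add: Omega_set_def)
    also have "\<dots> = (\<Prod>j=1..k. rate j ^ \<nu> j / fact (\<nu> j) * (t ^ \<nu> j * exp (- rate j * t)))"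
      using assms by (intro prod.cong refl) (simp add: pmf_poisson0 power_mult_distrib less_imp_le)
    also have "\<dots> = (\<Prod>j=1..k. rate j ^ \<nu> j / fact (\<nu> j)) *
        (t ^ (\<Sum>j=1..k. \<nu> j) * exp (- (\<Sum>j=1..k. rate j) * t))"
      by (simp add: prod.distrib prod_dividef power_sum exp_sum[symmetric] sum_distrib_right sum_negf)
    finally show "pmf ?Q \<nu> = \<dots>" .
  qed
  finally show ?thesis .
qed

text \<open>The exponent is additive over the components, so each \<open>j\<close> is tilted by
  \<open>j * b\<close>. After the multinomial expansion, independence makes every summand a product
  of Poisson moments.\<close>

lemma gcp_pmf_tilted_moment:
  assumes "\<And>j. j \<in> {1..k} \<Longrightarrow> rate j > 0" "t \<ge> 0" "b > 0"
  shows "measure_pmf.expectation (gcp_pmf k rate t) (\<lambda>m. real m ^ z * exp (- b * real m)) =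
    (\<Sum>r\<in>compositions k z. fact z * (\<Prod>j=1..k. real j ^ r j / fact (r j) *
      exp (- rate j * t * (1 - exp (- real j * b))) *
      bell_poly (r j) (exp (- real j * b) * rate j * t)))"
proof -
  let ?Q = "Pi_pmf {1..k} undefined (\<lambda>j. poisson0_pmf (rate j * t))"
  \<comment> \<open>Keeping \<open>j\<close> inside both the power and the tilt fits
    \<open>poisson0_tilted_moment\<close> with \<open>c = real j\<close> and
    \<open>real j * b\<close> for \<open>b\<close>.\<close>
  let ?f = "\<lambda>r j m. (real j * real m) ^ r j * exp (- (real j * b) * real m)"
  have a: "rate j * t \<ge> 0" "real j * b > 0" if "j \<in> {1..k}" for j
    using assms(1)[OF that] assms(2,3) that by auto
  have expand: "real (\<Sum>j=1..k. j * \<nu> j) ^ z * exp (- b * real (\<Sum>j=1..k. j * \<nu> j)) =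
      (\<Sum>r\<in>compositions k z. fact z / (\<Prod>j=1..k. fact (r j)) * (\<Prod>j=1..k. ?f r j (\<nu> j)))" for \<nu>
  proof -
    have "exp (- b * real (\<Sum>j=1..k. j * \<nu> j)) = (\<Prod>j=1..k. exp (- (real j * b) * real (\<nu> j)))"
      by (simp add: exp_sum[symmetric] sum_distrib_left sum_negf mult_ac)
    moreover have "real (\<Sum>j=1..k. j * \<nu> j) ^ z =
        (\<Sum>r\<in>compositions k z. fact z * (\<Prod>j=1..k. (real j * real (\<nu> j)) ^ r j / fact (r j)))"
      unfolding compositions_def of_nat_sum of_nat_mult by (rule multinomial_ring) simp
    ultimately show ?thesis
      by (simp add: sum_distrib_left sum_distrib_right prod.distrib prod_dividef mult_ac)
  qed
  have int: "integrable (measure_pmf (poisson0_pmf (rate j * t))) (?f r j)" if "j \<in> {1..k}" for j r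
    using a(2)[OF that] by (rule integrable_power_times_exp_pmf)
  have int_prod: "integrable (measure_pmf ?Q)
      (\<lambda>\<nu>. fact z / (\<Prod>j=1..k. fact (r j)) * (\<Prod>j=1..k. ?f r j (\<nu> j)))" for r
    by (intro integrable_mult_right integrable_prod_Pi_pmf int) auto
  have "measure_pmf.expectation (gcp_pmf k rate t) (\<lambda>m. real m ^ z * exp (- b * real m)) =
    measure_pmf.expectation ?Q (\<lambda>\<nu>. \<Sum>r\<in>compositions k z.
      fact z / (\<Prod>j=1..k. fact (r j)) * (\<Prod>j=1..k. ?f r j (\<nu> j)))"
    unfolding gcp_pmf_def integral_map_pmf expand ..
  also have "\<dots> = (\<Sum>r\<in>compositions k z. fact z / (\<Prod>j=1..k. fact (r j)) *
      measure_pmf.expectation ?Q (\<lambda>\<nu>. \<Prod>j=1..k. ?f r j (\<nu> j)))"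
    by (simp only: Bochner_Integration.integral_sum[OF int_prod] integral_mult_right_zero)
  also have "\<dots> = (\<Sum>r\<in>compositions k z. fact z / (\<Prod>j=1..k. fact (r j)) *
      (\<Prod>j=1..k. measure_pmf.expectation (poisson0_pmf (rate j * t)) (?f r j)))"
    by (intro sum.cong refl arg_cong2[where f = "(*)"] expectation_prod_Pi_pmf int) auto
  also have "\<dots> = (\<Sum>r\<in>compositions k z. fact z / (\<Prod>j=1..k. fact (r j)) *
      (\<Prod>j=1..k. real j ^ r j * exp (- (rate j * t) * (1 - exp (- (real j * b)))) *
        bell_poly (r j) (exp (- (real j * b)) * (rate j * t))))"
    by (intro sum.cong refl arg_cong2[where f = "(*)"] prod.cong poisson0_tilted_moment a)
  also have "\<dots> = (\<Sum>r\<in>compositions k z. fact z * (\<Prod>j=1..k. real j ^ r j / fact (r j) *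
      exp (- rate j * t * (1 - exp (- real j * b))) *
      bell_poly (r j) (exp (- real j * b) * rate j * t)))"
    by (simp add: prod.distrib prod_dividef mult_ac)
  finally show ?thesis .
qed

section \<open>The iterated process\<close>

text \<open>Total probability over the values \<open>m\<close> of \<open>M0 t\<close>: on each such
  event the outer process is read at the fixed time \<open>m\<close>, where independence splits the
  joint probability.\<close>

lemma prob_iterated_process:
  assumes "generalized_counting_process P k0 mu M0"
    and "generalized_counting_process P k lam M"
    and "independent_processes P M0 M"
    and "t \<ge> 0"
  shows "\<P>(\<omega> in P. iterated_process M M0 t \<omega> = n) =
    measure_pmf.expectation (gcp_pmf k0 mu t) (\<lambda>m. pmf (gcp_pmf k lam (real m)) n)"
proof -
  interpret M0: generalized_counting_process P k0 mu M0 by fact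
  interpret M: generalized_counting_process P k lam M by fact
  have marginal: "M0.prob (X s -` {i} \<inter> space P) = pmf (gcp_pmf l rate s) i"
    if "generalized_counting_process P l rate X" "s \<ge> 0" for l rate X s i
  proof -
    interpret X: generalized_counting_process P l rate X by fact
    show ?thesis
      using X.distr_eq_gcp_pmf[OF that(2)] X.random_variable[OF that(2)]
      by (metis measure_distr measurable_distr UNIV_I pmf.rep_eq sets_count_space Pow_UNIV)
  qed
  have joint: "M0.prob {\<omega> \<in> space P. M0 t \<omega> = m \<and> M s \<omega> = n} =
      pmf (gcp_pmf k0 mu t) m * pmf (gcp_pmf k lam s) n" if "s \<ge> 0" for m s
  proof -
    let ?S = "PiM {0..} (\<lambda>_. count_space UNIV) :: (real \<Rightarrow> nat) measure"
    \<comment> \<open>Independence of the paths passes to single times by coordinate projections,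
      which are measurable on the product space.\<close>
    have "M0.indep_var (count_space UNIV) ((\<lambda>x. x t) \<circ> (\<lambda>\<omega>. \<lambda>t\<in>{0..}. M0 t \<omega>))
        (count_space UNIV) ((\<lambda>x. x s) \<circ> (\<lambda>\<omega>. \<lambda>t\<in>{0..}. M t \<omega>))"
      using assms(3,4) that unfolding independent_processes_def
      by (elim M0.indep_var_compose) (auto intro!: measurable_component_singleton)
    then have "M0.indep_var (count_space UNIV) (M0 t) (count_space UNIV) (M s)"
      using assms(4) that by (simp add: comp_def)
    from M0.indep_varD[OF this, of "{m}" "{n}"] show ?thesis
      using marginal[OF assms(1,4), of m] marginal[OF assms(2) that, of n]
      by (simp add: vimage_def Int_def conj_commute)
  qed
  have "(\<lambda>m. M0.prob {\<omega> \<in> space P. M0 t \<omega> = m \<and> M (real m) \<omega> = n}) sums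
      M0.prob (\<Union>m. {\<omega> \<in> space P. M0 t \<omega> = m \<and> M (real m) \<omega> = n})"
  proof (rule M0.finite_measure_UNION)
    have "{\<omega> \<in> space P. M0 t \<omega> = m \<and> M (real m) \<omega> = n} =
        (M0 t -` {m} \<inter> space P) \<inter> (M (real m) -` {n} \<inter> space P)" for m
      by auto
    then show "range (\<lambda>m. {\<omega> \<in> space P. M0 t \<omega> = m \<and> M (real m) \<omega> = n}) \<subseteq> M0.events"
      using measurable_sets[OF M0.random_variable[OF assms(4)]]
        measurable_sets[OF M.random_variable[OF of_nat_0_le_iff]] by auto
  qed (auto simp: disjoint_family_on_def)
  also have "(\<Union>m. {\<omega> \<in> space P. M0 t \<omega> = m \<and> M (real m) \<omega> = n}) =
      {\<omega> \<in> space P. iterated_process M M0 t \<omega> = n}"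
    by (auto simp: iterated_process_def)
  finally have "(\<lambda>m. pmf (gcp_pmf k0 mu t) m * pmf (gcp_pmf k lam (real m)) n) sums
      \<P>(\<omega> in P. iterated_process M M0 t \<omega> = n)"
    by (simp add: joint)
  moreover have "integrable (measure_pmf (gcp_pmf k0 mu t)) (\<lambda>m. pmf (gcp_pmf k lam (real m)) n)"
    by (rule measure_pmf.integrable_const_bound[where B = 1]) (auto simp: pmf_le_1)
  ultimately show ?thesis
    using sums_expectation_nat_pmf sums_unique2 by blast
qed

theorem theorem3p1:
  fixes P :: "'a measure"
    and k0 k n :: nat
    and mu lam :: "nat \<Rightarrow> real"
    and M0 M :: "real \<Rightarrow> 'a \<Rightarrow> nat"
    and t \<Lambda> :: real
  assumes "generalized_counting_process P k0 mu M0"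
    and "generalized_counting_process P k lam M"
    and "independent_processes P M0 M"
    and "\<Lambda> = (\<Sum>j=1..k. lam j)"
    and "t \<ge> 0"
  shows "\<P>(\<omega> in P. iterated_process M M0 t \<omega> = n) =
    (\<Sum>\<nu>\<in>Omega_set k n.
      (\<Prod>j=1..k. lam j ^ \<nu> j / fact (\<nu> j)) *
      (\<Sum>r\<in>compositions k0 (\<Sum>j=1..k. \<nu> j).
        fact (\<Sum>j=1..k. \<nu> j) *
        (\<Prod>j0=1..k0. real j0 ^ r j0 / fact (r j0) *
          exp (- mu j0 * t * (1 - exp (- real j0 * \<Lambda>))) *
          bell_poly (r j0) (exp (- real j0 * \<Lambda>) * mu j0 * t))))"
proof -
  interpret M0: generalized_counting_process P k0 mu M0 by fact
  interpret M: generalized_counting_process P k lam M by fact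
  \<comment> \<open>At least one rate is present, so the exponential tilt is strict; this keeps the
    powers of \<open>m\<close> integrable.\<close>
  have \<Lambda>: "\<Lambda> > 0"
    unfolding assms(4) using M.num_rates by (intro sum_pos M.rate_pos) auto
  \<comment> \<open>The mass formula of the outer process is taken at time \<open>real m\<close>,
    which leaves tilted powers with \<open>b = \<Lambda>\<close> to be averaged under the inner
    law.\<close>
  have "\<P>(\<omega> in P. iterated_process M M0 t \<omega> = n) =
    measure_pmf.expectation (gcp_pmf k0 mu t) (\<lambda>m. \<Sum>\<nu>\<in>Omega_set k n.
      (\<Prod>j=1..k. lam j ^ \<nu> j / fact (\<nu> j)) *
      (real m ^ (\<Sum>j=1..k. \<nu> j) * exp (- \<Lambda> * real m)))"
    unfolding prob_iterated_process[OF assms(1-3,5)] assms(4)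
    by (intro Bochner_Integration.integral_cong refl pmf_gcp_pmf M.rate_pos) auto
  also have "\<dots> = (\<Sum>\<nu>\<in>Omega_set k n. (\<Prod>j=1..k. lam j ^ \<nu> j / fact (\<nu> j)) *
      measure_pmf.expectation (gcp_pmf k0 mu t)
        (\<lambda>m. real m ^ (\<Sum>j=1..k. \<nu> j) * exp (- \<Lambda> * real m)))"
    using integrable_power_times_exp_pmf[OF \<Lambda>, of _ 1]
    by (subst Bochner_Integration.integral_sum) auto
  also have "\<dots> = (\<Sum>\<nu>\<in>Omega_set k n.
      (\<Prod>j=1..k. lam j ^ \<nu> j / fact (\<nu> j)) *
      (\<Sum>r\<in>compositions k0 (\<Sum>j=1..k. \<nu> j).
        fact (\<Sum>j=1..k. \<nu> j) *
        (\<Prod>j0=1..k0. real j0 ^ r j0 / fact (r j0) *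
          exp (- mu j0 * t * (1 - exp (- real j0 * \<Lambda>))) *
          bell_poly (r j0) (exp (- real j0 * \<Lambda>) * mu j0 * t))))"
    by (intro sum.cong refl arg_cong2[where f = "(*)"] gcp_pmf_tilted_moment M0.rate_pos \<Lambda> assms(5))
  finally show ?thesis .
qed

end
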